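(* Let $X=(X_1,X_2,\ldots)$ be a stationary, $\psi$-mixing source with values in a finite set $\mathbb X$, let $d:\mathbb X\times\mathbb X\to[0,\infty)$ be a single-letter distortion measure with $d(x,x)=0$ for all $x$, and let $D>0$. Let $c=\langle c^n\rangle_{n\ge1}$ be a channel that directly communicates the source $X$ within distortion $D$. Then every rate $R<R^P_X(D)$ is reliably achievable over $c$.
   Context: The source reproduction alphabet is $\mathbb Y=\mathbb X$. For $x^n,y^n\in\mathbb X^n$, $d^n(x^n,y^n)=\sum_{i=1}^n d(x^n(i),y^n(i))$. For a sequence $X_a,\dots,X_b$ write $X_a^b$. $\psi$-mixing: for $\tau\in\{0,1,2,\ldots\}$ let $\psi(\tau)=\sup_{t\in\mathbb N}\sup_{\mathbb A,\mathbb B}\left|\frac{\Pr(X_1^t\in\mathbb A,\,X_{t+\tau+1}^\infty\in\mathbb B)}{\Pr(X_1^t\in\mathbb A)\Pr(X_{t+\tau+1}^\infty\in\mathbb B)}-1\right|$, where the inner supremum is over $\mathbb A\subseteq\mathbb X^t$ and Borel (product $\sigma$-field) sets $\mathbb B$ of sequences indexed by times $t+\tau+1,t+\tau+2,\ldots$, with both probabilities in the denominator positive. $X$ is $\psi$-mixing if $\psi(\tau)\to0$ as $\tau\to\infty$. Rate-distortion function under probability of excess distortion: a rate $R$ source code is a sequence $(e^n,f^n)$ with $e^n:\mathbb X^n\to\{1,\ldots,2^{\lfloor nR\rfloor}\}$, $f^n:\{1,\ldots,2^{\lfloor nR\rfloor}\}\to\mathbb X^n$; $R$ is achievable if $\lim_{n\to\infty}\Pr\big(\tfrac1n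 d^n(X^n,f^n(e^n(X^n)))>D\big)=0$; $R^P_X(D)$ is the infimum of achievable rates. Channel: $c=\langle c^n\rangle$ with $c^n:\mathbb X^n\to\mathcal P(\mathbb X^n)$, $c^n(y^n|x^n)$ the probability of output $y^n$ given input $x^n$. $c$ directly communicates $X$ within distortion $D$ if, when $X^n$ is input to $c^n$ with output $Y^n$, $\Pr(\tfrac1n d^n(X^n,Y^n)>D)\le\omega_n$ for some $\omega_n\to0$. Channel codes: with $\mathbb M_R^n=\{1,\ldots,2^{\lfloor nR\rfloor}\}$, a rate $R$ deterministic encoder is $e^n_{ch}:\mathbb M_R^n\to\mathbb X^n$ and decoder $f^n_{ch}:\mathbb X^n\to\mathbb M_R^n\cup\{\mathrm e\}$ ($\mathrm e$ = error); random codes (a joint distribution over deterministic encoder–decoder pairs) are allowed. With $g^n=e^n_{ch}\circ c^n\circ f^n_{ch}$, rate $R$ is reliably achievable over $c$ if there is a rate $R$ code and $\delta_n\to0$ with $\sup_{m\in\mathbb M_R^n} g^n(\{m\}^c|m)\le\delta_n$. *)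

theory Defs
  imports "HOL-Probability.Probability"
begin

text \<open>Conventions. A source is a probability measure M on sequences nat => 'a
(product sigma-field); coordinate i (0-based) is the paper's X_(i+1).
Blocks x^n are lists of length n.\<close>

definition seq_space :: "(nat \<Rightarrow> 'a) measure" where
  "seq_space = Pi\<^sub>M UNIV (\<lambda>_. count_space UNIV)"

definition block :: "nat \<Rightarrow> (nat \<Rightarrow> 'a) \<Rightarrow> 'a list" where
  "block n \<omega> = map \<omega> [0..<n]"

definition stationary :: "(nat \<Rightarrow> 'a) measure \<Rightarrow> bool" where
  "stationary M \<longleftrightarrow> distr M M (\<lambda>\<omega> i. \<omega> (Suc i)) = M"

text \<open>psi-mixing coefficient: sup over t >= 1, A a set of length-t blocks, and
measurable B of sequences indexed by times t+tau+1, t+tau+2, ... (paper indexing).\<close>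

definition psi_coeff :: "(nat \<Rightarrow> 'a) measure \<Rightarrow> nat \<Rightarrow> ereal" where
  "psi_coeff M \<tau> =
     (SUP tAB \<in> {(t, A, B). t \<ge> 1 \<and> A \<subseteq> {xs. length xs = t} \<and> B \<in> sets seq_space
         \<and> measure M {\<omega> \<in> space M. block t \<omega> \<in> A} > 0
         \<and> measure M {\<omega> \<in> space M. (\<lambda>k. \<omega> (t + \<tau> + k)) \<in> B} > 0}.
       (case tAB of (t, A, B) \<Rightarrow>
         ereal \<bar>measure M {\<omega> \<in> space M. block t \<omega> \<in> A \<and> (\<lambda>k. \<omega> (t + \<tau> + k)) \<in> B}
              / (measure M {\<omega> \<in> space M. block t \<omega> \<in> A}
                 * measure M {\<omega> \<in> space M. (\<lambda>k. \<omega> (t + \<tau> + k)) \<in> B}) - 1\<bar>))"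

definition psi_mixing :: "(nat \<Rightarrow> 'a) measure \<Rightarrow> bool" where
  "psi_mixing M \<longleftrightarrow> psi_coeff M \<longlonglongrightarrow> 0"

definition dist_n :: "('a \<Rightarrow> 'a \<Rightarrow> real) \<Rightarrow> 'a list \<Rightarrow> 'a list \<Rightarrow> real" where
  "dist_n d xs ys = (\<Sum>i<length xs. d (xs ! i) (ys ! i))"

definition msgs :: "nat \<Rightarrow> real \<Rightarrow> nat set" where
  "msgs n R = {1 .. 2 ^ nat \<lfloor>real n * R\<rfloor>}"

definition source_achievable ::
  "(nat \<Rightarrow> 'a) measure \<Rightarrow> ('a \<Rightarrow> 'a \<Rightarrow> real) \<Rightarrow> real \<Rightarrow> real \<Rightarrow> bool" where
  "source_achievable M d D R \<longleftrightarrow> R \<ge> 0 \<and>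
     (\<exists>(e :: nat \<Rightarrow> 'a list \<Rightarrow> nat) (f :: nat \<Rightarrow> nat \<Rightarrow> 'a list).
        (\<forall>n xs. length xs = n \<longrightarrow> e n xs \<in> msgs n R) \<and>
        (\<forall>n m. m \<in> msgs n R \<longrightarrow> length (f n m) = n) \<and>
        (\<lambda>n. measure M {\<omega> \<in> space M.
              dist_n d (block n \<omega>) (f n (e n (block n \<omega>))) / real n > D}) \<longlonglongrightarrow> 0)"

definition RD_P :: "(nat \<Rightarrow> 'a) measure \<Rightarrow> ('a \<Rightarrow> 'a \<Rightarrow> real) \<Rightarrow> real \<Rightarrow> real" where
  "RD_P M d D = Inf {R. source_achievable M d D R}"

definition is_channel :: "(nat \<Rightarrow> 'a list \<Rightarrow> 'a list pmf) \<Rightarrow> bool" where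
  "is_channel c \<longleftrightarrow> (\<forall>n xs. length xs = n \<longrightarrow> (\<forall>y \<in> set_pmf (c n xs). length y = n))"

definition directly_communicates ::
  "(nat \<Rightarrow> 'a) measure \<Rightarrow> ('a \<Rightarrow> 'a \<Rightarrow> real) \<Rightarrow> (nat \<Rightarrow> 'a list \<Rightarrow> 'a list pmf) \<Rightarrow> real \<Rightarrow> bool" where
  "directly_communicates M d c D \<longleftrightarrow>
     (\<exists>\<omega>s :: nat \<Rightarrow> real. \<omega>s \<longlonglongrightarrow> 0 \<and>
       (\<forall>n \<ge> 1. (\<Sum>xs \<in> {xs. length xs = n}.
            measure M {\<omega> \<in> space M. block n \<omega> = xs}
            * measure_pmf.prob (c n xs) {y. dist_n d xs y / real n > D}) \<le> \<omega>s n))"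

text \<open>Random channel code of rate R: for each n a distribution over deterministic
encoder/decoder pairs; the decoder output None is the error symbol.\<close>
definition valid_code :: "nat \<Rightarrow> real \<Rightarrow> (nat \<Rightarrow> 'a list) \<times> ('a list \<Rightarrow> nat option) \<Rightarrow> bool" where
  "valid_code n R ed \<longleftrightarrow>
     (\<forall>m \<in> msgs n R. length (fst ed m) = n) \<and>
     (\<forall>y. length y = n \<longrightarrow> snd ed y \<in> Some ` msgs n R \<union> {None})"

definition code_error ::
  "(nat \<Rightarrow> 'a list \<Rightarrow> 'a list pmf) \<Rightarrow> nat \<Rightarrow> ((nat \<Rightarrow> 'a list) \<times> ('a list \<Rightarrow> nat option)) pmf
   \<Rightarrow> nat \<Rightarrow> real" where
  "code_error c n C m =
     measure_pmf.expectation C (\<lambda>(enc, dec). measure_pmf.prob (c n (enc m)) {y. dec y \<noteq> Some m})"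

definition reliably_achievable :: "(nat \<Rightarrow> 'a list \<Rightarrow> 'a list pmf) \<Rightarrow> real \<Rightarrow> bool" where
  "reliably_achievable c R \<longleftrightarrow>
     (\<exists>(C :: nat \<Rightarrow> ((nat \<Rightarrow> 'a list) \<times> ('a list \<Rightarrow> nat option)) pmf) (\<delta> :: nat \<Rightarrow> real).
        (\<forall>n. \<forall>ed \<in> set_pmf (C n). valid_code n R ed) \<and> \<delta> \<longlonglongrightarrow> 0 \<and>
        (\<forall>n \<ge> 1. \<forall>m \<in> msgs n R. code_error c n (C n) m \<le> \<delta> n))"

end

theory Submission
  imports Defs "HOL-Real_Asymp.Real_Asymp"
begin

text \<open>
  Fix \<open>R < R' < R1 < RD_P M d D\<close> and let \<open>T n\<close> be the set of inputs for which \<open>c n\<close> exceeds distortion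
  \<open>D\<close> with small probability; it has source probability tending to 1. Call the set of words within
  distortion \<open>D\<close> of \<open>y\<close> the ball around \<open>y\<close>.

  \<^item> If, along some infinite set of block lengths \<open>n\<close>, \<open>2 powr (n * R')\<close> balls could cover probability
    arbitrarily close to 1, then concatenating such covers, and storing verbatim the few blocks that
    are missed, would make \<open>R1\<close> an achievable source rate: by stationarity and Markov's inequality the
    fraction of missed blocks is small with high probability. Hence for all large \<open>n\<close> the set \<open>T n\<close>
    needs more than \<open>2 powr (n * R')\<close> balls.

  \<^item> By the duality between covers and fractional packings, in the form of the dual-fitting analysis
    of greedy set cover, \<open>T n\<close> then carries a distribution that gives every ball mass at most
    \<open>harm (card (T n)) / 2 powr (n * R')\<close>.

  \<^item> Draw \<open>2 powr (n * R)\<close> independent codewords from this distribution and decode to the unique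
    codeword within distortion \<open>D\<close> of the output. The transmitted codeword qualifies because it lies
    in \<open>T n\<close>; another codeword qualifies with probability at most the mass of a ball, whatever the
    channel output is.
\<close>

subsection \<open>Greedy covers and spread-out distributions\<close>

text \<open>Each of the \<open>a - b\<close> summands of \<open>harm\<close> between
  \<open>b\<close> and \<open>a\<close> is at least \<open>1 / a\<close>, hence at least
  \<open>1 / k\<close>. In the greedy cover this converts the prices paid in one round into a
  decrease of \<open>harm\<close>.\<close>

lemma harm_diff_ge:
  fixes a b k :: nat
  assumes "b \<le> a" "a \<le> k"
  shows "real (a - b) / real k \<le> harm a - harm b"
  using assms
proof (induction a)
  case (Suc a)
  show ?case
  proof (cases "b = Suc a")
    case False
    then have "b \<le> a" using Suc.prems by simp
    then have "real (a - b) / real k \<le> harm a - harm b" using Suc by simp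
    moreover have "1 / real k \<le> 1 / real (Suc a)"
      using Suc.prems by (intro divide_left_mono) auto
    ultimately show ?thesis
      using \<open>b \<le> a\<close> by (simp add: harm_Suc Suc_diff_le add_divide_distrib inverse_eq_divide)
  qed simp
qed simp

lemma harm_le_ln: "n > 0 \<Longrightarrow> harm n \<le> 1 + ln (real n)"
  using decseqD[OF decseq_harm_diff_ln, of 0 "n - 1"] by (simp add: harm_expand)

text \<open>The weights are the prices of the greedy set cover: a point covered in a round that covers
  \<open>k\<close> new points is charged \<open>1 / k\<close>.\<close>

lemma greedy_cover_weights:
  fixes B :: "'i \<Rightarrow> 'b set"
  assumes "finite T" "finite Y" "T \<subseteq> (\<Union>y\<in>Y. B y)"
  shows "\<exists>(w :: 'b \<Rightarrow> real) S. (\<forall>x. w x \<ge> 0) \<and> S \<subseteq> Y \<and> T \<subseteq> (\<Union>y\<in>S. B y) \<and>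
           real (card S) \<le> sum w T \<and> (\<forall>y\<in>Y. sum w (T \<inter> B y) \<le> harm (card (T \<inter> B y)))"
  using assms
proof (induction "card T" arbitrary: T rule: less_induct)
  case less
  show ?case
  proof (cases "T = {}")
    case True
    then show ?thesis by (intro exI[of _ "\<lambda>_. 0"] exI[of _ "{}"]) (auto simp: harm_nonneg)
  next
    case False
    then have "Y \<noteq> {}" using less.prems by auto
    \<comment> \<open>The greedy choice: \<open>y0\<close> covers as many points of \<open>T\<close>
      as any single set can. Maximality of \<open>k\<close> is the side condition of
      \<open>harm_diff_ge\<close> for every other \<open>B y\<close>.\<close>
    define k where "k = Max ((\<lambda>y. card (T \<inter> B y)) ` Y)"
    have "k \<in> (\<lambda>y. card (T \<inter> B y)) ` Y"
      unfolding k_def using \<open>Y \<noteq> {}\<close> less.prems by (intro Max_in) auto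
    then obtain y0 where y0: "y0 \<in> Y" "k = card (T \<inter> B y0)" by auto
    have kmax: "card (T \<inter> B y) \<le> k" if "y \<in> Y" for y
      unfolding k_def using that less.prems by (intro Max_ge) auto
    obtain x where "x \<in> T" using False by auto
    then obtain y where "y \<in> Y" "x \<in> T \<inter> B y" using less.prems by auto
    then have "card (T \<inter> B y) > 0" using less.prems by (auto simp: card_gt_0_iff)
    then have kpos: "k > 0" using kmax[OF \<open>y \<in> Y\<close>] by simp
    define T' where "T' = T - B y0"
    have "T' \<subset> T" using kpos y0 less.prems unfolding T'_def by (auto simp: card_gt_0_iff)
    then have "card T' < card T" using less.prems by (simp add: psubset_card_mono)
    moreover have "finite T'" "T' \<subseteq> (\<Union>y\<in>Y. B y)" using less.prems unfolding T'_def by auto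
    ultimately obtain w' S' where w':
      "\<forall>x. w' x \<ge> 0" "S' \<subseteq> Y" "T' \<subseteq> (\<Union>y\<in>S'. B y)" "real (card S') \<le> sum w' T'"
      "\<forall>y\<in>Y. sum w' (T' \<inter> B y) \<le> harm (card (T' \<inter> B y))"
      using less.hyps[of T'] less.prems(2) by metis
    define w where "w = (\<lambda>x. if x \<in> B y0 then 1 / real k else w' x)"
    have split: "sum w A = real (card (A \<inter> B y0)) / real k + sum w' (A - B y0)"
      if "finite A" for A
    proof -
      have "sum w A = sum w (A \<inter> B y0) + sum w (A - B y0)"
        using that by (rule sum.Int_Diff)
      then show ?thesis by (simp add: w_def)
    qed
    \<comment> \<open>The \<open>k\<close> points of this round are charged \<open>1 / k\<close>
      each, which pays exactly for \<open>y0\<close>.\<close>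
    have "card (insert y0 S') \<le> Suc (card S')" by (rule card_insert_le_m1) auto
    then have 1: "real (card (insert y0 S')) \<le> sum w T"
      using split[of T] less.prems w'(4) kpos unfolding T'_def y0(2)[symmetric] by simp
    \<comment> \<open>The round charges \<open>1 / k\<close> to each point by which
      \<open>T \<inter> B y\<close> shrinks to \<open>T' \<inter> B y\<close>; the induction
      hypothesis bounds the later prices, and the two bounds telescope.\<close>
    have 2: "sum w (T \<inter> B y) \<le> harm (card (T \<inter> B y))" if "y \<in> Y" for y
    proof -
      have eq: "T \<inter> B y - B y0 = T' \<inter> B y" by (auto simp: T'_def)
      have fin: "finite (T \<inter> B y)" using less.prems by auto
      have "card (T \<inter> B y \<inter> B y0) + card (T' \<inter> B y) = card (T \<inter> B y)"
        using card_Int_Diff[OF fin, of "B y0"] eq by simp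
      then have "card (T \<inter> B y \<inter> B y0) = card (T \<inter> B y) - card (T' \<inter> B y)"
        "card (T' \<inter> B y) \<le> card (T \<inter> B y)" by linarith+
      then show ?thesis
        using split[OF fin] harm_diff_ge[of "card (T' \<inter> B y)" "card (T \<inter> B y)" k]
          kmax[OF that] w'(5) that eq by fastforce
    qed
    have "\<forall>x. w x \<ge> 0" using w'(1) by (auto simp: w_def)
    moreover have "insert y0 S' \<subseteq> Y" using w'(2) y0 by auto
    moreover have "T \<subseteq> (\<Union>y\<in>insert y0 S'. B y)" using w'(3) by (auto simp: T'_def)
    ultimately show ?thesis using 1 2 by blast
  qed
qed

text \<open>Normalize the greedy prices. Their total is at least the size of the greedy cover, which
  exceeds \<open>N\<close> by \<open>hard\<close>, while the prices inside one \<open>B y\<close>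
  add up to at most a harmonic number.\<close>

lemma spread_distribution:
  fixes B :: "'i \<Rightarrow> 'b set" and N :: real
  assumes "finite T" "finite Y" "T \<subseteq> (\<Union>y\<in>Y. B y)" "N > 0"
    and hard: "\<And>S. S \<subseteq> Y \<Longrightarrow> T \<subseteq> (\<Union>y\<in>S. B y) \<Longrightarrow> real (card S) > N"
  shows "\<exists>Q. set_pmf Q \<subseteq> T \<and> (\<forall>y\<in>Y. measure_pmf.prob Q (B y) \<le> harm (card T) / N)"
proof -
  obtain w S where w: "\<forall>x. w x \<ge> (0::real)" "S \<subseteq> Y" "T \<subseteq> (\<Union>y\<in>S. B y)"
    "real (card S) \<le> sum w T" "\<forall>y\<in>Y. sum w (T \<inter> B y) \<le> harm (card (T \<inter> B y))"
    using greedy_cover_weights[OF assms(1-3)] by metis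
  define W where "W = sum w T"
  have W: "W > N" using hard[OF w(2,3)] w(4) by (simp add: W_def)
  define q where "q = (\<lambda>x. if x \<in> T then w x / W else 0)"
  have qnn: "q x \<ge> 0" for x using w(1) W assms(4) by (auto simp: q_def)
  have "(\<integral>\<^sup>+x. ennreal (q x) \<partial>count_space UNIV) = (\<Sum>x\<in>T. ennreal (q x))"
    using assms(1) by (intro nn_integral_count_space') (auto simp: q_def)
  also have "\<dots> = ennreal (\<Sum>x\<in>T. q x)" using qnn by simp
  also have "(\<Sum>x\<in>T. q x) = 1" using W assms(4) by (simp add: q_def W_def flip: sum_divide_distrib)
  finally have int: "(\<integral>\<^sup>+x. ennreal (q x) \<partial>count_space UNIV) = 1" by simp
  define Q where "Q = embed_pmf q"
  have pmfQ: "pmf Q x = q x" for x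
    unfolding Q_def using qnn int by (intro pmf_embed_pmf) auto
  have supp: "set_pmf Q \<subseteq> T" by (auto simp: set_pmf_eq pmfQ q_def)
  have "measure_pmf.prob Q (B y) \<le> harm (card T) / N" if "y \<in> Y" for y
  proof -
    have "measure_pmf.prob Q (B y) = measure_pmf.prob Q (T \<inter> B y)"
      by (rule measure_eq_AE) (use supp in \<open>auto simp: AE_measure_pmf_iff\<close>)
    also have "\<dots> = sum w (T \<inter> B y) / W"
      using assms(1) by (subst measure_measure_pmf_finite) (auto simp: pmfQ q_def sum_divide_distrib)
    also have "\<dots> \<le> harm (card T) / W"
      using w(5) that W assms(1,4)
      by (intro divide_right_mono order_trans[OF _ harm_mono[OF card_mono[of T "T \<inter> B y"]]]) auto
    also have "\<dots> \<le> harm (card T) / N"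
      using W assms(4) by (intro divide_left_mono) (auto simp: harm_nonneg)
    finally show ?thesis .
  qed
  with supp show ?thesis by blast
qed

subsection \<open>Random codes\<close>

text \<open>Uniqueness is demanded of the message, not of the codeword: codewords are drawn with
  repetition, and two messages sharing a matching codeword also lead to \<open>None\<close>.\<close>

definition unique_decoder :: "('x \<Rightarrow> 'y \<Rightarrow> bool) \<Rightarrow> 'm set \<Rightarrow> ('m \<Rightarrow> 'x) \<Rightarrow> 'y \<Rightarrow> 'm option" where
  "unique_decoder match A f y =
     (if \<exists>!m. m \<in> A \<and> match (f m) y then Some (THE m. m \<in> A \<and> match (f m) y) else None)"

lemma unique_decoder_range: "unique_decoder match A f y \<in> Some ` A \<union> {None}"
  unfolding unique_decoder_def using theI'[of "\<lambda>m. m \<in> A \<and> match (f m) y"] by auto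

lemma unique_decoder_correct:
  assumes "m \<in> A" "match (f m) y" "\<And>m'. m' \<in> A - {m} \<Longrightarrow> \<not> match (f m') y"
  shows "unique_decoder match A f y = Some m"
proof -
  have "\<exists>!m. m \<in> A \<and> match (f m) y" using assms by blast
  moreover have "(THE m. m \<in> A \<and> match (f m) y) = m" using assms by blast
  ultimately show ?thesis by (simp add: unique_decoder_def)
qed

text \<open>Both orders of averaging give the probability that independent draws from
  \<open>Q\<close> and \<open>p\<close> match. Writing it as the probability of \<open>True\<close>
  in a Boolean experiment turns the exchange of integrals into
  \<open>bind_commute_pmf\<close>.\<close>

lemma prob_match_swap:
  assumes "\<And>z. z \<in> set_pmf p \<Longrightarrow> measure_pmf.prob Q {x. match x z} \<le> q"
  shows "measure_pmf.expectation Q (\<lambda>x. measure_pmf.prob p {z. match x z}) \<le> q"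
proof -
  have "measure_pmf.expectation Q (\<lambda>x. measure_pmf.prob p {z. match x z})
      = pmf (bind_pmf Q (\<lambda>x. bind_pmf p (\<lambda>z. return_pmf (match x z)))) True"
    by (simp add: pmf_bind pmf_map vimage_def flip: map_pmf_def)
  also have "\<dots> = pmf (bind_pmf p (\<lambda>z. bind_pmf Q (\<lambda>x. return_pmf (match x z)))) True"
    by (subst bind_commute_pmf) simp
  also have "\<dots> = measure_pmf.expectation p (\<lambda>z. measure_pmf.prob Q {x. match x z})"
    by (simp add: pmf_bind pmf_map vimage_def flip: map_pmf_def)
  also have "\<dots> \<le> q"
    using assms by (intro measure_pmf.integral_le_const measure_pmf.integrable_const_bound[where B=1])
      (auto simp: AE_measure_pmf_iff)
  finally show ?thesis .
qed

text \<open>The codeword of \<open>m'\<close> is independent of that of \<open>m\<close>, hence of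
  the channel output. With the other codewords fixed, averaging over this one is the situation of
  \<open>prob_match_swap\<close>.\<close>

lemma random_codeword_confusion:
  fixes ch :: "'x \<Rightarrow> 'y pmf"
  assumes "finite A" "m \<in> A" "m' \<in> A" "m \<noteq> m'" "set_pmf Q \<subseteq> X"
    and "\<And>x z. x \<in> X \<Longrightarrow> z \<in> set_pmf (ch x) \<Longrightarrow> measure_pmf.prob Q {x'. match x' z} \<le> q"
  shows "measure_pmf.expectation (Pi_pmf A dflt (\<lambda>_. Q))
           (\<lambda>f. measure_pmf.prob (ch (f m)) {z. match (f m') z}) \<le> q"
proof -
  let ?P = "Pi_pmf (A - {m'}) dflt (\<lambda>_. Q)"
  let ?g = "\<lambda>x x'. measure_pmf.prob (ch x) {z. match x' z}"
  let ?h = "\<lambda>f. bind_pmf (ch (f m)) (\<lambda>z. return_pmf (match (f m') z))"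
  have "measure_pmf.expectation (Pi_pmf A dflt (\<lambda>_. Q)) (\<lambda>f. ?g (f m) (f m'))
    = pmf (bind_pmf (Pi_pmf A dflt (\<lambda>_. Q)) ?h) True"
    by (simp add: pmf_bind pmf_map vimage_def flip: map_pmf_def)
  \<comment> \<open>Coordinate \<open>m'\<close> is split off and drawn separately. As
    \<open>m \<noteq> m'\<close>, the update does not change the transmitted codeword
    \<open>f m\<close>.\<close>
  also have "\<dots> = pmf (bind_pmf ?P (\<lambda>f. bind_pmf Q (\<lambda>y. ?h (f(m' := y))))) True"
    using Pi_pmf_insert'[of "A - {m'}" m' dflt "\<lambda>_. Q"] assms(1,3)
    by (simp add: insert_absorb bind_assoc_pmf bind_return_pmf bind_commute_pmf[of Q])
  also have "\<dots> = measure_pmf.expectation ?P (\<lambda>f. measure_pmf.expectation Q (\<lambda>y. ?g (f m) y))"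
    using assms(4) by (simp add: pmf_bind pmf_map vimage_def flip: map_pmf_def)
  also have "\<dots> \<le> q"
  proof (intro measure_pmf.integral_le_const measure_pmf.integrable_const_bound[where B=1])
    show "AE f in ?P. norm (measure_pmf.expectation Q (\<lambda>y. ?g (f m) y)) \<le> 1"
      by (intro AE_pmfI) (auto simp: integral_nonneg_AE intro!: measure_pmf.integral_le_const measure_pmf.integrable_const_bound[where B=1])
    show "AE f in ?P. measure_pmf.expectation Q (\<lambda>y. ?g (f m) y) \<le> q"
    proof (rule AE_pmfI)
      fix f assume "f \<in> set_pmf ?P"
      then have "f m \<in> X" using assms(1,2,4,5) by (auto simp: set_Pi_pmf PiE_dflt_def)
      then show "measure_pmf.expectation Q (\<lambda>y. ?g (f m) y) \<le> q"
        using assms(6) by (intro prob_match_swap) auto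
    qed
  qed auto
  finally show ?thesis .
qed

text \<open>A union bound for each fixed code, averaged afterwards: decoding fails only if the sent
  codeword does not match the output or some other codeword does.\<close>

lemma random_code_error:
  fixes ch :: "'x \<Rightarrow> 'y pmf"
  assumes "finite A" "m \<in> A" "set_pmf Q \<subseteq> X" "q \<ge> 0"
    and miss: "\<And>x. x \<in> X \<Longrightarrow> measure_pmf.prob (ch x) {y. \<not> match x y} \<le> s"
    and clash: "\<And>x z. x \<in> X \<Longrightarrow> z \<in> set_pmf (ch x) \<Longrightarrow> measure_pmf.prob Q {x'. match x' z} \<le> q"
  shows "measure_pmf.expectation (Pi_pmf A dflt (\<lambda>_. Q))
           (\<lambda>f. measure_pmf.prob (ch (f m)) {y. unique_decoder match A f y \<noteq> Some m})
         \<le> s + real (card A) * q"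
proof -
  let ?P = "Pi_pmf A dflt (\<lambda>_. Q)"
  let ?g = "\<lambda>m' f. measure_pmf.prob (ch (f m)) {z. match (f m') z}"
  have int: "integrable ?P (\<lambda>f. ?g m' f)" for m'
    by (intro measure_pmf.integrable_const_bound[where B=1]) auto
  have "measure_pmf.expectation ?P
           (\<lambda>f. measure_pmf.prob (ch (f m)) {y. unique_decoder match A f y \<noteq> Some m})
      \<le> measure_pmf.expectation ?P (\<lambda>f. s + (\<Sum>m'\<in>A-{m}. ?g m' f))"
  proof (rule integral_mono_AE)
    show "integrable ?P (\<lambda>f. measure_pmf.prob (ch (f m)) {y. unique_decoder match A f y \<noteq> Some m})"
      by (intro measure_pmf.integrable_const_bound[where B=1]) auto
    show "integrable ?P (\<lambda>f. s + (\<Sum>m'\<in>A-{m}. ?g m' f))"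
      using int by (intro Bochner_Integration.integrable_add Bochner_Integration.integrable_sum) auto
    show "AE f in ?P. measure_pmf.prob (ch (f m)) {y. unique_decoder match A f y \<noteq> Some m}
                        \<le> s + (\<Sum>m'\<in>A-{m}. ?g m' f)"
    proof (rule AE_pmfI)
      fix f assume "f \<in> set_pmf ?P"
      then have "f m \<in> X" using assms(1-3) by (auto simp: set_Pi_pmf PiE_dflt_def)
      have "measure_pmf.prob (ch (f m)) {y. unique_decoder match A f y \<noteq> Some m}
          \<le> measure_pmf.prob (ch (f m)) ({y. \<not> match (f m) y} \<union> (\<Union>m'\<in>A-{m}. {z. match (f m') z}))"
        using unique_decoder_correct[of m A match f] assms(2)
        by (intro measure_pmf.finite_measure_mono) auto
      also have "\<dots> \<le> measure_pmf.prob (ch (f m)) {y. \<not> match (f m) y}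
                   + measure_pmf.prob (ch (f m)) (\<Union>m'\<in>A-{m}. {z. match (f m') z})"
        by (intro measure_Un_le) auto
      also have "\<dots> \<le> s + (\<Sum>m'\<in>A-{m}. ?g m' f)"
        using assms(1) \<open>f m \<in> X\<close>
        by (intro add_mono miss measure_UNION_le) auto
      finally show "measure_pmf.prob (ch (f m)) {y. unique_decoder match A f y \<noteq> Some m}
                        \<le> s + (\<Sum>m'\<in>A-{m}. ?g m' f)" .
    qed
  qed
  also have "\<dots> = s + (\<Sum>m'\<in>A-{m}. measure_pmf.expectation ?P (?g m'))"
    using int by (subst Bochner_Integration.integral_add) (auto simp: Bochner_Integration.integral_sum)
  also have "\<dots> \<le> s + (\<Sum>m'\<in>A-{m}. q)"
    using assms by (intro add_left_mono sum_mono random_codeword_confusion[where X=X]) auto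
  also have "\<dots> \<le> s + real (card A) * q"
    using assms(1,2,4) by (auto intro!: mult_right_mono)
  finally show ?thesis .
qed

subsection \<open>Source codes by concatenation\<close>

lemma finite_words: "finite {xs :: 'a::finite list. length xs = n}"
  using finite_lists_length_eq[of "UNIV :: 'a set" n] by simp

lemma card_words: "card {xs :: 'a::finite list. length xs = n} = CARD('a) ^ n"
  using card_lists_length_eq[of "UNIV :: 'a set" n] by simp

text \<open>Stated without division by \<open>n\<close>, so that the distortion budgets of
  consecutive blocks simply add up.\<close>

definition covered :: "('a \<Rightarrow> 'a \<Rightarrow> real) \<Rightarrow> real \<Rightarrow> nat \<Rightarrow> 'a list set \<Rightarrow> 'a list set" where
  "covered d D n S = {x. length x = n \<and> (\<exists>y\<in>S. dist_n d x y \<le> real n * D)}"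

lemma dist_n_append:
  "length u = length u' \<Longrightarrow> dist_n d (u @ v) (u' @ v') = dist_n d u u' + dist_n d v v'"
  by (induction u u' rule: list_induct2) (simp_all add: dist_n_def sum.lessThan_Suc_shift del: sum.lessThan_Suc)

text \<open>\<open>t\<close> is the budget of blocks stored verbatim instead of being quantized to \<open>S\<close>.\<close>

fun patched_words :: "'a list set \<Rightarrow> nat \<Rightarrow> nat \<Rightarrow> nat \<Rightarrow> nat \<Rightarrow> 'a list set" where
  "patched_words S n r 0 t = {xs. length xs = r}"
| "patched_words S n r (Suc L) t =
     (\<lambda>(u, v). u @ v) ` (S \<times> patched_words S n r L t) \<union>
     (case t of 0 \<Rightarrow> {} | Suc t' \<Rightarrow>
        (\<lambda>(u, v). u @ v) ` ({u. length u = n} \<times> patched_words S n r L t'))"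

lemma length_patched_words:
  "S \<subseteq> {xs. length xs = n} \<Longrightarrow> y \<in> patched_words S n r L t \<Longrightarrow> length y = L * n + r"
  by (induction L arbitrary: t y) (auto split: nat.splits)

lemma finite_patched_words: "finite S \<Longrightarrow> finite (patched_words (S :: 'a::finite list set) n r L t)"
  by (induction L arbitrary: t) (auto simp: finite_words split: nat.splits)

text \<open>A verbatim block costs a factor \<open>CARD('a) ^ n\<close> but lowers the budget by
  one, so both branches are multiples of the same bound: \<open>card S\<close> copies plus one. This
  gives the base \<open>card S + 1\<close>; the last factor counts the tail of length
  \<open>r\<close>.\<close>

lemma card_patched_words:
  fixes S :: "'a::finite list set"
  assumes "finite S"
  shows "card (patched_words S n r L t) \<le> (card S + 1) ^ L * CARD('a) ^ (n * t) * CARD('a) ^ r"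
proof (induction L arbitrary: t)
  case 0
  show ?case by (simp add: card_words)
next
  case (Suc L)
  let ?K = "CARD('a)" and ?W = "patched_words S n r"
  have fin: "finite (?W L t)" for t using assms by (rule finite_patched_words)
  have 1: "card ((\<lambda>(u, v). u @ v) ` (S \<times> ?W L t))
      \<le> card S * ((card S + 1) ^ L * ?K ^ (n * t) * ?K ^ r)"
    using assms fin
    by (intro le_trans[OF card_image_le]) (simp_all only: card_cartesian_product finite_cartesian_product mult_le_mono2 Suc.IH)
  show ?case
  proof (cases t)
    case 0
    then show ?thesis using 1 by (simp add: algebra_simps)
  next
    case (Suc t')
    have "card ((\<lambda>(u, v). u @ v) ` ({u :: 'a list. length u = n} \<times> ?W L t'))
      \<le> ?K ^ n * ((card S + 1) ^ L * ?K ^ (n * t') * ?K ^ r)"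
      using fin by (intro le_trans[OF card_image_le])
        (simp_all only: card_cartesian_product finite_cartesian_product finite_words card_words mult_le_mono2 Suc.IH)
    also have "\<dots> = (card S + 1) ^ L * ?K ^ (n * t) * ?K ^ r"
      by (simp add: Suc power_add)
    finally show ?thesis
      using 1 card_Un_le[of "(\<lambda>(u, v). u @ v) ` (S \<times> ?W L t)"
          "(\<lambda>(u, v). u @ v) ` ({u :: 'a list. length u = n} \<times> ?W L t')"]
      by (simp add: Suc algebra_simps)
  qed
qed

text \<open>Read the blocks from the left. A covered block is replaced by a nearby word of
  \<open>S\<close>; a missed block is copied at distortion 0 and uses one unit of the budget
  \<open>t\<close>; the tail is copied as well.\<close>

lemma covered_patched_words:
  assumes "S \<subseteq> {xs. length xs = n}" "D \<ge> 0" "\<forall>x. d x x = 0"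
    and "length x = L * n + r"
    and "(\<Sum>i<L. of_bool (take n (drop (i * n) x) \<notin> covered d D n S)) \<le> t"
  shows "x \<in> covered d D (L * n + r) (patched_words S n r L t)"
  using assms(4,5)
proof (induction L arbitrary: x t)
  case 0
  have "dist_n d x x = 0" using assms(3) by (simp add: dist_n_def)
  then show ?case using 0 assms(2) by (auto simp: covered_def intro!: bexI[of _ x])
next
  case (Suc L)
  define u v where "u = take n x" and "v = drop n x"
  have x: "x = u @ v" "length u = n" "length v = L * n + r"
    using Suc.prems by (auto simp: u_def v_def)
  define b where "b = (\<Sum>i<L. of_bool (take n (drop (i * n) v) \<notin> covered d D n S) :: nat)"
  have tot: "of_bool (u \<notin> covered d D n S) + b \<le> t"
    using Suc.prems(2) unfolding sum.lessThan_Suc_shift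
    by (simp add: b_def u_def v_def add.commute)
  have dist: "dist_n d x (u' @ v') \<le> real (Suc L * n + r) * D"
    if "length u' = n" "dist_n d u u' \<le> real n * D" "dist_n d v v' \<le> real (L * n + r) * D" for u' v'
    using that x by (simp add: dist_n_append algebra_simps)
  show ?case
  proof (cases "u \<in> covered d D n S")
    case True
    then have "v \<in> covered d D (L * n + r) (patched_words S n r L t)"
      using Suc.IH[of v t] x tot by (simp add: b_def)
    then obtain v' where v': "v' \<in> patched_words S n r L t" "dist_n d v v' \<le> real (L * n + r) * D"
      by (auto simp: covered_def)
    obtain u' where u': "u' \<in> S" "dist_n d u u' \<le> real n * D"
      using True by (auto simp: covered_def)
    have "u' @ v' \<in> patched_words S n r (Suc L) t" using u' v' by force
    moreover have "length u' = n" using u' assms(1) by auto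
    ultimately show ?thesis
      using dist[OF _ u'(2) v'(2)] Suc.prems(1) by (auto simp: covered_def)
  next
    case False
    then obtain t' where t': "t = Suc t'" "b \<le> t'" using tot by (cases t) auto
    then have "v \<in> covered d D (L * n + r) (patched_words S n r L t')"
      using Suc.IH[of v t'] x by (simp add: b_def)
    then obtain v' where v': "v' \<in> patched_words S n r L t'" "dist_n d v v' \<le> real (L * n + r) * D"
      by (auto simp: covered_def)
    have "u @ v' \<in> patched_words S n r (Suc L) t" using x v' t' by force
    moreover have "dist_n d u u \<le> real n * D" using assms(2,3) by (simp add: dist_n_def)
    ultimately show ?thesis
      using dist[OF x(2) _ v'(2)] Suc.prems(1) by (auto simp: covered_def)
  qed
qed

section \<open>Measurability and stationarity of finite windows\<close>

lemma measurable_map_coords: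
  fixes M :: "(nat \<Rightarrow> 'a::finite) measure"
  assumes "sets M = sets seq_space"
  shows "(\<lambda>\<omega>. map \<omega> is) \<in> measurable M (count_space UNIV)"
proof -
  have coord: "(\<lambda>\<omega>. \<omega> i) \<in> measurable M (count_space (UNIV :: 'a set))" for i
    using measurable_component_singleton[of i UNIV "\<lambda>_. count_space (UNIV :: 'a set)"]
    by (simp add: measurable_cong_sets[OF assms refl] seq_space_def)
  show ?thesis
  proof (induction "is")
    case (Cons i "is")
    have "(\<lambda>\<omega>. a # map \<omega> is) \<in> measurable M (count_space UNIV)" for a
      by (rule measurable_compose[OF Cons]) simp
    from measurable_compose_countable[OF this coord[of i]] show ?case by simp
  qed simp
qed

lemma sets_map_coords:
  fixes M :: "(nat \<Rightarrow> 'a::finite) measure"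
  assumes "sets M = sets seq_space"
  shows "{\<omega> \<in> space M. map \<omega> is \<in> A} \<in> sets M"
  using measurable_sets[OF measurable_map_coords[OF assms], of A "is"]
  by (simp add: vimage_def Int_def conj_commute)

lemma stationary_window:
  fixes M :: "(nat \<Rightarrow> 'a::finite) measure"
  assumes "sets M = sets seq_space" "stationary M"
  shows "measure M {\<omega> \<in> space M. map \<omega> [s..<s + n] \<in> A} = measure M {\<omega> \<in> space M. block n \<omega> \<in> A}"
proof (induction s)
  case 0
  show ?case by (simp add: block_def)
next
  case (Suc s)
  let ?sh = "\<lambda>\<omega> i. \<omega> (Suc i)"
  have sp: "space M = UNIV"
    using sets_eq_imp_space_eq[OF assms(1)] by (simp add: seq_space_def space_PiM)
  have sh: "(?sh :: (nat \<Rightarrow> 'a) \<Rightarrow> _) \<in> measurable M M"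
    unfolding measurable_cong_sets[OF assms(1) assms(1)] seq_space_def
    by (rule measurable_PiM_single') (auto intro!: measurable_component_singleton)
  have "measure M {\<omega> \<in> space M. map \<omega> [s..<s + n] \<in> A}
      = measure (distr M M ?sh) {\<omega> \<in> space M. map \<omega> [s..<s + n] \<in> A}"
    using assms(2) by (simp add: stationary_def)
  also have "\<dots> = measure M (?sh -` {\<omega> \<in> space M. map \<omega> [s..<s + n] \<in> A} \<inter> space M)"
    by (rule measure_distr[OF sh sets_map_coords[OF assms(1)]])
  also have "?sh -` {\<omega> \<in> space M. map \<omega> [s..<s + n] \<in> A} \<inter> space M
      = {\<omega> \<in> space M. map \<omega> [Suc s..<Suc s + n] \<in> A}"
  proof -
    have "map (?sh \<omega>) [s..<s + n] = map \<omega> [Suc s..<Suc s + n]" for \<omega> :: "nat \<Rightarrow> 'a"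
      by (rule nth_equalityI) (auto simp del: upt_Suc)
    then show ?thesis by (auto simp: sp)
  qed
  finally show ?case using Suc by simp
qed

text \<open>By stationarity every block is missed with probability at most
  \<open>\<eta>\<^sup>2\<close>, so the expected number of misses is at most
  \<open>L * \<eta>\<^sup>2\<close>, and Markov's inequality bounds the probability of exceeding the
  budget by \<open>\<eta>\<close>.\<close>

lemma prob_covered_concat:
  fixes M :: "(nat \<Rightarrow> 'a::finite) measure"
  assumes "prob_space M" "sets M = sets seq_space" "stationary M"
    and S: "S \<subseteq> {xs. length xs = n}" and D: "D \<ge> 0" and d: "\<forall>x. d x x = 0"
    and "\<eta> > 0" and p: "measure M {\<omega> \<in> space M. block n \<omega> \<in> covered d D n S} \<ge> 1 - \<eta>\<^sup>2"
  shows "measure M {\<omega> \<in> space M. block (L * n + r) \<omega>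
           \<in> covered d D (L * n + r) (patched_words S n r L (nat \<lfloor>\<eta> * real L\<rfloor>))} \<ge> 1 - \<eta>"
proof -
  interpret prob_space M by fact
  define t where "t = nat \<lfloor>\<eta> * real L\<rfloor>"
  define k where "k = L * n + r"
  define bad where "bad i = {\<omega> \<in> space M. map \<omega> [i * n..<i * n + n] \<in> - covered d D n S}" for i
  define u where "u \<omega> = (\<Sum>i<L. indicator (bad i) \<omega> :: real)" for \<omega>
  have bad_sets: "bad i \<in> sets M" for i
    unfolding bad_def by (rule sets_map_coords[OF assms(2)])
  have "{\<omega> \<in> space M. block n \<omega> \<in> - covered d D n S} = space M - {\<omega> \<in> space M. block n \<omega> \<in> covered d D n S}"
    by auto
  then have "prob {\<omega> \<in> space M. block n \<omega> \<in> - covered d D n S}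
      = 1 - prob {\<omega> \<in> space M. block n \<omega> \<in> covered d D n S}"
    using prob_compl[OF sets_map_coords[OF assms(2)], of "[0..<n]" "covered d D n S"]
    by (simp add: block_def)
  then have bad_le: "prob (bad i) \<le> \<eta>\<^sup>2" for i
    unfolding bad_def stationary_window[OF assms(2,3)] using p by simp
  have ind_int: "integrable M (indicator (bad i) :: _ \<Rightarrow> real)" for i
    using bad_sets by (intro integrable_real_indicator) (auto simp: emeasure_eq_measure)
  have uint: "integrable M u"
    unfolding u_def using ind_int by (intro Bochner_Integration.integrable_sum)
  have "expectation u = (\<Sum>i<L. prob (bad i))"
    unfolding u_def using ind_int bad_sets sets.sets_into_space[OF bad_sets]
    by (subst Bochner_Integration.integral_sum) (auto simp: Int_absorb2)
  also have "\<dots> \<le> (\<Sum>i<L. \<eta>\<^sup>2)" by (intro sum_mono bad_le)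
  finally have Eu: "expectation u \<le> real L * \<eta>\<^sup>2" by simp
  \<comment> \<open>The count \<open>u\<close> takes integer values, so exceeding \<open>t\<close>
    means reaching \<open>t + 1\<close>. This threshold is at least \<open>\<eta> * L\<close> in
    spite of the floor in \<open>t\<close>.\<close>
  have "prob {\<omega> \<in> space M. u \<omega> \<ge> real t + 1} \<le> expectation u / (real t + 1)"
    by (rule integral_Markov_inequality_measure[OF uint, of "{}"]) (auto simp: u_def sum_nonneg)
  also have "\<dots> \<le> real L * \<eta>\<^sup>2 / (real t + 1)" using Eu by (simp add: divide_right_mono)
  also have "\<dots> \<le> \<eta>"
  proof -
    have "\<eta> * real L \<le> real t + 1" unfolding t_def by linarith
    then have "\<eta> * (\<eta> * real L) \<le> \<eta> * (real t + 1)" using assms(7) by (intro mult_left_mono) auto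
    then show ?thesis by (simp add: field_simps power2_eq_square)
  qed
  finally have markov: "prob {\<omega> \<in> space M. u \<omega> \<ge> real t + 1} \<le> \<eta>" .
  let ?G = "{\<omega> \<in> space M. block k \<omega> \<in> covered d D k (patched_words S n r L t)}"
  have "space M - {\<omega> \<in> space M. u \<omega> \<ge> real t + 1} \<subseteq> ?G"
  proof
    fix \<omega> assume "\<omega> \<in> space M - {\<omega> \<in> space M. u \<omega> \<ge> real t + 1}"
    then have \<omega>: "\<omega> \<in> space M" "u \<omega> < real t + 1" by auto
    have win: "take n (drop (i * n) (block k \<omega>)) = map \<omega> [i * n..<i * n + n]" if "i < L" for i
    proof -
      have "Suc i * n \<le> L * n" using that by (intro mult_le_mono1) simp
      then have "i * n + n \<le> k" by (simp add: k_def)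
      then show ?thesis by (simp add: block_def drop_map take_map)
    qed
    have "u \<omega> = (\<Sum>i<L. real (of_bool (take n (drop (i * n) (block k \<omega>)) \<notin> covered d D n S)))"
      unfolding u_def by (intro sum.cong refl) (use \<omega>(1) in \<open>auto simp: win bad_def indicator_def\<close>)
    then have "real (\<Sum>i<L. of_bool (take n (drop (i * n) (block k \<omega>)) \<notin> covered d D n S)) < real t + 1"
      using \<omega>(2) by simp
    then have "(\<Sum>i<L. of_bool (take n (drop (i * n) (block k \<omega>)) \<notin> covered d D n S)) \<le> t" by linarith
    then have "block k \<omega> \<in> covered d D k (patched_words S n r L t)"
      unfolding k_def by (intro covered_patched_words S D d) (simp_all add: block_def)
    then show "\<omega> \<in> ?G" using \<omega> by simp
  qed
  moreover have "{\<omega> \<in> space M. u \<omega> \<ge> real t + 1} \<in> sets M"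
    using borel_measurable_integrable[OF uint] by measurable
  moreover have "?G \<in> sets M"
    unfolding block_def by (rule sets_map_coords[OF assms(2)])
  ultimately have "1 - prob {\<omega> \<in> space M. u \<omega> \<ge> real t + 1} \<le> prob ?G"
    using finite_measure_mono[of _ ?G] by (simp add: prob_compl[symmetric])
  then show ?thesis using markov unfolding k_def t_def by simp
qed

section \<open>Source codes from covers\<close>

lemma source_code_of_cover:
  fixes S :: "'a list set"
  assumes "finite S" "S \<subseteq> {xs. length xs = n}" "card S \<le> 2 ^ nat \<lfloor>real n * R\<rfloor>" "n > 0"
  shows "\<exists>e f. (\<forall>xs. length xs = n \<longrightarrow> e xs \<in> msgs n R) \<and> (\<forall>m\<in>msgs n R. length (f m) = n) \<and>
           (\<forall>xs\<in>covered d D n S. dist_n d xs (f (e xs)) / real n \<le> D)"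
proof -
  obtain h where h: "bij_betw h {1..card S} S" using ex_bij_betw_nat_finite_1[OF assms(1)] by auto
  \<comment> \<open>Messages beyond \<open>card S\<close> decode to a filler of the right length.
    The fallback message 1 of the encoder lies in \<open>msgs n R\<close> for every rate.\<close>
  define f where "f m = (if m \<in> {1..card S} then h m else replicate n undefined)" for m
  define e where "e xs = (if \<exists>m\<in>msgs n R. dist_n d xs (f m) \<le> real n * D
    then SOME m. m \<in> msgs n R \<and> dist_n d xs (f m) \<le> real n * D else 1)" for xs
  have e: "e xs \<in> msgs n R \<and> dist_n d xs (f (e xs)) \<le> real n * D"
    if "\<exists>m\<in>msgs n R. dist_n d xs (f m) \<le> real n * D" for xs
    using someI_ex[of "\<lambda>m. m \<in> msgs n R \<and> dist_n d xs (f m) \<le> real n * D"] that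
    by (auto simp: e_def)
  have "e xs \<in> msgs n R" for xs
  proof (cases "\<exists>m\<in>msgs n R. dist_n d xs (f m) \<le> real n * D")
    case False
    then show ?thesis unfolding e_def by (simp add: msgs_def)
  qed (use e in blast)
  moreover have "length (f m) = n" for m
    using bij_betwE[OF h] assms(2) by (auto simp: f_def)
  moreover have "dist_n d xs (f (e xs)) / real n \<le> D" if xs: "xs \<in> covered d D n S" for xs
  proof -
    obtain y where y: "y \<in> S" "dist_n d xs y \<le> real n * D" using xs by (auto simp: covered_def)
    then obtain m where m: "m \<in> {1..card S}" "h m = y"
      using h unfolding bij_betw_def by (metis imageE)
    then have "m \<in> msgs n R" "f m = y" using assms(3) by (auto simp: msgs_def f_def)
    then have "dist_n d xs (f (e xs)) \<le> real n * D" using e[of xs] y by blast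
    then show ?thesis using assms(4) by (simp add: field_simps)
  qed
  ultimately show ?thesis by blast
qed

text \<open>The covers supplied by \<open>cov\<close> depend on the tolerance, whereas a source code
  is a single sequence. Taking for each \<open>n\<close> a most probable cover among those of
  admissible size does at least as well for every tolerance.\<close>

lemma source_achievableI_cover:
  fixes M :: "(nat \<Rightarrow> 'a::finite) measure"
  assumes "prob_space M" "sets M = sets seq_space" "R \<ge> 0"
    and cov: "\<And>\<epsilon>. \<epsilon> > 0 \<Longrightarrow> \<forall>\<^sub>F n in sequentially. \<exists>S. S \<subseteq> {xs. length xs = n} \<and>
           card S \<le> 2 ^ nat \<lfloor>real n * R\<rfloor> \<and>
           measure M {\<omega> \<in> space M. block n \<omega> \<in> covered d D n S} \<ge> 1 - \<epsilon>"
  shows "source_achievable M d D R"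
proof -
  interpret prob_space M by fact
  define P where "P n S = prob {\<omega> \<in> space M. block n \<omega> \<in> covered d D n S}" for n S
  define F where "F n = {S :: 'a list set. S \<subseteq> {xs. length xs = n} \<and> card S \<le> 2 ^ nat \<lfloor>real n * R\<rfloor>}" for n
  have "\<exists>S\<in>F n. \<forall>S'\<in>F n. P n S' \<le> P n S" for n
  proof -
    have "F n \<subseteq> Pow {xs. length xs = n}" by (auto simp: F_def)
    then have fin: "finite (F n)" by (rule finite_subset) (simp add: finite_words)
    moreover have "{} \<in> F n" by (simp add: F_def)
    ultimately have "Max (P n ` F n) \<in> P n ` F n" by (intro Max_in) auto
    then obtain S where "S \<in> F n" "P n S = Max (P n ` F n)" by auto
    then show ?thesis using fin by (intro bexI[of _ S]) auto
  qed
  then obtain S where S: "\<And>n. S n \<in> F n" "\<And>n S'. S' \<in> F n \<Longrightarrow> P n S' \<le> P n (S n)" by metis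
  have "\<exists>e f. (\<forall>xs. length xs = n \<longrightarrow> e xs \<in> msgs n R) \<and> (\<forall>m\<in>msgs n R. length (f m) = n) \<and>
       (n > 0 \<longrightarrow> (\<forall>xs\<in>covered d D n (S n). dist_n d xs (f (e xs)) / real n \<le> D))" for n
  proof (cases "n > 0")
    case True
    have "finite (S n)" "S n \<subseteq> {xs. length xs = n}" "card (S n) \<le> 2 ^ nat \<lfloor>real n * R\<rfloor>"
      using S(1)[of n] finite_subset[OF _ finite_words] by (auto simp: F_def)
    from source_code_of_cover[OF this True, of d D] show ?thesis by blast
  next
    case False
    then show ?thesis by (intro exI[of _ "\<lambda>_. 1"] exI[of _ "\<lambda>_. []"]) (auto simp: msgs_def)
  qed
  then obtain e f where ef: "\<And>n xs. length xs = n \<Longrightarrow> e n xs \<in> msgs n R"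
    "\<And>n m. m \<in> msgs n R \<Longrightarrow> length (f n m) = n"
    "\<And>n xs. n > 0 \<Longrightarrow> xs \<in> covered d D n (S n) \<Longrightarrow> dist_n d xs (f n (e n xs)) / real n \<le> D"
    by metis
  let ?E = "\<lambda>n. {\<omega> \<in> space M. dist_n d (block n \<omega>) (f n (e n (block n \<omega>))) / real n > D}"
  have bound: "prob (?E n) \<le> 1 - P n (S n)" if "n > 0" for n
  proof -
    let ?G = "{\<omega> \<in> space M. block n \<omega> \<in> covered d D n (S n)}"
    have G: "?G \<in> sets M" unfolding block_def by (rule sets_map_coords[OF assms(2)])
    have "?E n \<subseteq> space M - ?G" using ef(3)[OF that] by fastforce
    then have "prob (?E n) \<le> prob (space M - ?G)" using G by (intro finite_measure_mono) auto
    then show ?thesis using prob_compl[OF G] by (simp add: P_def)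
  qed
  have "(\<lambda>n. prob (?E n)) \<longlonglongrightarrow> 0"
  proof (rule tendstoI)
    fix \<epsilon> :: real assume "\<epsilon> > 0"
    then have "\<forall>\<^sub>F n in sequentially. \<exists>S'\<in>F n. P n S' \<ge> 1 - \<epsilon> / 2"
      using cov[of "\<epsilon> / 2"] by (simp add: F_def P_def Bex_def conj_assoc)
    then show "\<forall>\<^sub>F n in sequentially. dist (prob (?E n)) 0 < \<epsilon>"
      using eventually_gt_at_top[of 0]
    proof eventually_elim
      case (elim n)
      then obtain S' where "S' \<in> F n" "P n S' \<ge> 1 - \<epsilon> / 2" by blast
      then have "P n (S n) \<ge> 1 - \<epsilon> / 2" using S(2)[of S' n] by simp
      then have "prob (?E n) < \<epsilon>" using bound[OF elim(2)] \<open>\<epsilon> > 0\<close> by simp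
      then show ?case by simp
    qed
  qed
  then show ?thesis
    unfolding source_achievable_def using ef(1,2) assms(3) by blast
qed

text \<open>One sufficiently long good block length \<open>n\<close> serves all large
  \<open>k\<close>: cut \<open>k\<close> letters into \<open>k div n\<close> blocks and a tail. The
  excess rate \<open>R - R'\<close> is split into quarters, one each for the extra bit per block,
  the verbatim blocks, and the tail together with rounding.\<close>

lemma source_achievable_of_infinitely_many_covers:
  fixes M :: "(nat \<Rightarrow> 'a::finite) measure"
  assumes "prob_space M" "sets M = sets seq_space" "stationary M"
    and D: "D \<ge> 0" and d: "\<forall>x. d x x = 0" and R: "0 \<le> R'" "R' < R"
    and cov: "\<And>\<eta> N. \<eta> > 0 \<Longrightarrow> \<exists>n\<ge>N. \<exists>S. S \<subseteq> {xs. length xs = n} \<and>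
           real (card S) \<le> 2 powr (real n * R') \<and>
           measure M {\<omega> \<in> space M. block n \<omega> \<in> covered d D n S} \<ge> 1 - \<eta>"
  shows "source_achievable M d D R"
proof (rule source_achievableI_cover[OF assms(1,2)])
  show "R \<ge> 0" using R by simp
  fix \<epsilon> :: real assume "\<epsilon> > 0"
  let ?K = "CARD('a)"
  define \<delta> where "\<delta> = R - R'"
  \<comment> \<open>Bits needed to store one letter verbatim.\<close>
  define l where "l = log 2 (real ?K)"
  have K: "real ?K \<ge> 1" by (simp add: Suc_leI)
  have l: "l \<ge> 0" using K by (simp add: l_def)
  have Kpow: "real ?K ^ j = 2 powr (real j * l)" for j
  proof -
    have "real ?K = 2 powr l" unfolding l_def using K by simp
    then show ?thesis by (simp add: powr_powr mult.commute flip: powr_realpow)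
  qed
  have \<delta>: "\<delta> > 0" using R by (simp add: \<delta>_def)
  \<comment> \<open>The first bound meets the probability target, the second keeps the rate
    \<open>\<eta> * l\<close> of the verbatim blocks below \<open>\<delta> / 4\<close>. The
    denominator uses \<open>l + 1\<close> because \<open>l = 0\<close> for a one-letter
    alphabet.\<close>
  define \<eta> where "\<eta> = min \<epsilon> (\<delta> / (4 * (l + 1)))"
  have \<eta>: "\<eta> > 0" "\<eta> \<le> \<epsilon>" using \<open>\<epsilon> > 0\<close> \<delta> l by (auto simp: \<eta>_def)
  have "\<eta> * l \<le> \<eta> * (l + 1)" using \<eta> by simp
  also have "\<dots> \<le> \<delta> / 4"
    using l min.cobounded2[of \<epsilon> "\<delta> / (4 * (l + 1))", folded \<eta>_def] by (simp add: field_simps)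
  finally have \<eta>l: "\<eta> * l \<le> \<delta> / 4" .
  \<comment> \<open>Passing from \<open>card S\<close> to \<open>card S + 1\<close> costs at most
    one bit per block, which is a rate of at most \<open>\<delta> / 4\<close> once
    \<open>n \<ge> 4 / \<delta>\<close>. The tolerance \<open>\<eta>\<^sup>2\<close> is the one that
    \<open>prob_covered_concat\<close> asks for.\<close>
  obtain n S where n: "n \<ge> max 1 (nat \<lceil>4 / \<delta>\<rceil>)" and S: "S \<subseteq> {xs. length xs = n}"
    "real (card S) \<le> 2 powr (real n * R')"
    "measure M {\<omega> \<in> space M. block n \<omega> \<in> covered d D n S} \<ge> 1 - \<eta>\<^sup>2"
    using cov[of "\<eta>\<^sup>2" "max 1 (nat \<lceil>4 / \<delta>\<rceil>)"] \<eta> by auto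
  have n0: "n > 0" using n by simp
  have "4 / \<delta> \<le> real n" using n by linarith
  then have n\<delta>: "1 \<le> real n * \<delta> / 4" using \<delta> by (simp add: field_simps)
  have finS: "finite S" using S(1) finite_words finite_subset by blast
  \<comment> \<open>The lower bound on \<open>k\<close> makes the at most \<open>n * l\<close> bits
    of the tail, plus one bit for rounding, fit into \<open>k * \<delta> / 4\<close>.\<close>
  have card_bound: "card (patched_words S n (k mod n) (k div n) (nat \<lfloor>\<eta> * real (k div n)\<rfloor>))
     \<le> 2 ^ nat \<lfloor>real k * R\<rfloor>" if k: "real k \<ge> 4 * (real n * l + 1) / \<delta>" for k
  proof -
    define L r t where "L = k div n" and "r = k mod n" and "t = nat \<lfloor>\<eta> * real L\<rfloor>"
    have kLr: "k = L * n + r" by (simp add: L_def r_def)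
    have Lnk: "real L * real n \<le> real k" by (simp add: kLr)
    have rn: "real r \<le> real n" using n0 by (simp add: r_def less_imp_le)
    have tL: "real t \<le> \<eta> * real L" unfolding t_def using \<eta> by simp
    have k\<delta>: "real n * l + 1 \<le> real k * \<delta> / 4" using k \<delta> by (simp add: field_simps)
    have "real (card S + 1) \<le> 2 powr (real n * R' + 1)"
    proof -
      have "1 \<le> 2 powr (real n * R')" using R by (simp add: ge_one_powr_ge_zero)
      then show ?thesis using S(2) by (simp add: powr_add)
    qed
    then have "real (card S + 1) ^ L \<le> (2 powr (real n * R' + 1)) ^ L" by (intro power_mono) auto
    also have "\<dots> = 2 powr (real L * (real n * R' + 1))" by (simp add: powr_powr mult.commute flip: powr_realpow)
    finally have SL: "real (card S + 1) ^ L \<le> 2 powr (real L * (real n * R' + 1))" .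
    have "real (card (patched_words S n r L t)) \<le> real ((card S + 1) ^ L * ?K ^ (n * t) * ?K ^ r)"
      using card_patched_words[OF finS, of n r L t] by (simp only: of_nat_le_iff)
    also have "\<dots> = real (card S + 1) ^ L * real ?K ^ (n * t) * real ?K ^ r" by simp
    also have "\<dots> \<le> 2 powr (real L * (real n * R' + 1)) * real ?K ^ (n * t) * real ?K ^ r"
      using SL by (intro mult_right_mono) auto
    also have "\<dots> = 2 powr (real L * (real n * R' + 1) + real (n * t) * l + real r * l)"
      by (simp add: Kpow powr_add)
    \<comment> \<open>The spare bit in the exponent absorbs the floor in
      \<open>nat \<lfloor>real k * R\<rfloor>\<close>.\<close>
    also have "\<dots> \<le> 2 powr (real k * R - 1)"
    proof (rule powr_mono)
      have "real L * real n * R' \<le> real k * R'" using Lnk R by (intro mult_right_mono) auto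
      moreover have "real L \<le> real k * \<delta> / 4"
      proof -
        have "real L * 1 \<le> real L * (real n * \<delta> / 4)" using n\<delta> by (intro mult_left_mono) auto
        also have "\<dots> = real L * real n * (\<delta> / 4)" by simp
        also have "\<dots> \<le> real k * (\<delta> / 4)" using Lnk \<delta> by (intro mult_right_mono) auto
        finally show ?thesis by simp
      qed
      moreover have "real (n * t) * l \<le> real k * \<delta> / 4"
      proof -
        have "real t * (real n * l) \<le> \<eta> * real L * (real n * l)"
          using tL l by (intro mult_right_mono) auto
        also have "\<dots> = real L * real n * (\<eta> * l)" by simp
        also have "\<dots> \<le> real k * (\<delta> / 4)"
          using Lnk \<eta>l \<eta> l by (intro mult_mono) auto
        finally show ?thesis by (simp add: mult.commute mult.left_commute)
      qed
      moreover have "real r * l \<le> real n * l" using rn l by (intro mult_right_mono) auto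
      moreover have "real k * R = real k * R' + real k * \<delta>" by (simp add: \<delta>_def algebra_simps)
      ultimately show "real L * (real n * R' + 1) + real (n * t) * l + real r * l \<le> real k * R - 1"
        using k\<delta> \<delta> by (simp add: distrib_left mult.assoc)
    qed simp
    also have "\<dots> \<le> 2 powr real (nat \<lfloor>real k * R\<rfloor>)" by (intro powr_mono) linarith+
    also have "\<dots> = real (2 ^ nat \<lfloor>real k * R\<rfloor>)" by (simp add: powr_realpow)
    finally show ?thesis unfolding L_def r_def t_def by (simp only: of_nat_le_iff)
  qed
  have "\<forall>\<^sub>F k in sequentially. real k \<ge> 4 * (real n * l + 1) / \<delta>"
    by (rule eventually_sequentiallyI[of "nat \<lceil>4 * (real n * l + 1) / \<delta>\<rceil>"]) linarith
  then show "\<forall>\<^sub>F k in sequentially. \<exists>S. S \<subseteq> {xs. length xs = k} \<and>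
           card S \<le> 2 ^ nat \<lfloor>real k * R\<rfloor> \<and>
           measure M {\<omega> \<in> space M. block k \<omega> \<in> covered d D k S} \<ge> 1 - \<epsilon>"
  proof eventually_elim
    case (elim k)
    let ?W = "patched_words S n (k mod n) (k div n) (nat \<lfloor>\<eta> * real (k div n)\<rfloor>)"
    have "?W \<subseteq> {xs. length xs = k}" using length_patched_words[OF S(1)] by fastforce
    moreover have "measure M {\<omega> \<in> space M. block k \<omega> \<in> covered d D k ?W} \<ge> 1 - \<epsilon>"
      using prob_covered_concat[OF assms(1-3) S(1) D _ \<eta>(1) S(3), of "k div n" "k mod n"] d \<eta>(2)
      by simp
    ultimately show ?case using card_bound[OF elim] by blast
  qed
qed

subsection \<open>Channel codes\<close>

text \<open>Covering \<open>T\<close> is expensive, so \<open>spread_distribution\<close> gives a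
  law on \<open>T\<close> under which all balls are light. Codewords drawn from it miss their own
  output with probability at most \<open>s\<close>, being in \<open>T\<close>, and rarely match
  another's output.\<close>

lemma channel_code_of_uncoverable:
  fixes d :: "'a::finite \<Rightarrow> 'a \<Rightarrow> real" and N s :: real
  assumes "is_channel c" "n > 0" "D \<ge> 0" "\<forall>x. d x x = 0" "N > 0"
  defines "T \<equiv> {x. length x = n \<and> measure_pmf.prob (c n x) {y. dist_n d x y / real n > D} \<le> s}"
  assumes hard: "\<And>S. S \<subseteq> {xs. length xs = n} \<Longrightarrow> T \<subseteq> covered d D n S \<Longrightarrow> real (card S) > N"
  shows "\<exists>C. (\<forall>ed\<in>set_pmf C. valid_code n R ed) \<and>
           (\<forall>m\<in>msgs n R. code_error c n C m \<le> s + real (card (msgs n R)) * (harm (card T) / N))"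
proof -
  define match where "match x y \<longleftrightarrow> dist_n d x y / real n \<le> D" for x y
  define Y where "Y = {xs :: 'a list. length xs = n}"
  have TY: "T \<subseteq> Y" by (auto simp: T_def Y_def)
  have finY: "finite Y" by (simp add: Y_def finite_words)
  have finT: "finite T" using TY finY by (rule finite_subset)
  have refl: "match x x" for x using assms(3,4) by (simp add: match_def dist_n_def)
  obtain Q where Q: "set_pmf Q \<subseteq> T"
    "\<And>y. y \<in> Y \<Longrightarrow> measure_pmf.prob Q {x. match x y} \<le> harm (card T) / N"
  proof -
    have "T \<subseteq> (\<Union>y\<in>Y. {x. match x y})" using TY refl by auto
    moreover have "real (card S) > N" if "S \<subseteq> Y" "T \<subseteq> (\<Union>y\<in>S. {x. match x y})" for S
    proof (rule hard)
      show "S \<subseteq> {xs. length xs = n}" using that by (simp add: Y_def)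
      show "T \<subseteq> covered d D n S"
        using that(2) TY assms(2) by (fastforce simp: covered_def match_def Y_def field_simps)
    qed
    ultimately show ?thesis
      using spread_distribution[of T Y "\<lambda>y. {x. match x y}" N] finT finY assms(5) that by blast
  qed
  let ?P = "Pi_pmf (msgs n R) [] (\<lambda>_. Q)"
  define C where "C = map_pmf (\<lambda>f. (f, unique_decoder match (msgs n R) f)) ?P"
  have finA: "finite (msgs n R)" by (simp add: msgs_def)
  have "valid_code n R ed" if ed: "ed \<in> set_pmf C" for ed
  proof -
    obtain f where f: "f \<in> set_pmf ?P" "ed = (f, unique_decoder match (msgs n R) f)"
      using ed unfolding C_def set_map_pmf by blast
    then have "f m \<in> T" if "m \<in> msgs n R" for m
      using that finA Q(1) by (auto simp: set_Pi_pmf PiE_dflt_def)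
    then show ?thesis
      using f(2) unique_decoder_range[of match "msgs n R" f] by (auto simp: valid_code_def T_def)
  qed
  moreover have "code_error c n C m \<le> s + real (card (msgs n R)) * (harm (card T) / N)"
    if "m \<in> msgs n R" for m
  proof -
    have "code_error c n C m = measure_pmf.expectation ?P
       (\<lambda>f. measure_pmf.prob (c n (f m)) {y. unique_decoder match (msgs n R) f y \<noteq> Some m})"
      by (simp add: code_error_def C_def)
    also have "\<dots> \<le> s + real (card (msgs n R)) * (harm (card T) / N)"
    proof (rule random_code_error[OF finA that Q(1)])
      show "0 \<le> harm (card T) / N" using assms(5) by (simp add: harm_nonneg)
      show "measure_pmf.prob (c n x) {y. \<not> match x y} \<le> s" if "x \<in> T" for x
        using that by (simp add: T_def match_def not_le)
      \<comment> \<open>Only balls around words of length \<open>n\<close> are known to be light;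
        \<open>is_channel\<close> guarantees that the output \<open>z\<close> is such a
        word.\<close>
      show "measure_pmf.prob Q {x'. match x' z} \<le> harm (card T) / N"
        if "x \<in> T" "z \<in> set_pmf (c n x)" for x z
        using that assms(1) by (intro Q(2)) (auto simp: is_channel_def T_def Y_def)
    qed
    finally show ?thesis .
  qed
  ultimately show ?thesis by blast
qed

lemma prob_block_eq_sum:
  fixes M :: "(nat \<Rightarrow> 'a::finite) measure"
  assumes "prob_space M" "sets M = sets seq_space" "finite A"
  shows "measure M {\<omega> \<in> space M. block n \<omega> \<in> A} = (\<Sum>x\<in>A. measure M {\<omega> \<in> space M. block n \<omega> = x})"
proof -
  interpret prob_space M by fact
  have sets: "{\<omega> \<in> space M. block n \<omega> = x} \<in> sets M" for x
    using sets_map_coords[OF assms(2), of "[0..<n]" "{x}"] by (simp add: block_def)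
  have "{\<omega> \<in> space M. block n \<omega> \<in> A} = (\<Union>x\<in>A. {\<omega> \<in> space M. block n \<omega> = x})" by auto
  then show ?thesis
    using finite_measure_finite_Union[OF assms(3), of "\<lambda>x. {\<omega> \<in> space M. block n \<omega> = x}"] sets
    by (auto simp: disjoint_family_on_def)
qed

text \<open>Markov's inequality for the average of \<open>bad\<close>: an average of at most
  \<open>s\<^sup>2\<close> leaves probability at most \<open>s\<close> for values above
  \<open>s\<close>.\<close>

lemma prob_good_inputs:
  fixes M :: "(nat \<Rightarrow> 'a::finite) measure" and bad :: "'a list \<Rightarrow> real"
  assumes "prob_space M" "sets M = sets seq_space" "s > 0" "\<And>x. bad x \<ge> 0"
    and "(\<Sum>xs\<in>{xs. length xs = n}. measure M {\<omega> \<in> space M. block n \<omega> = xs} * bad xs) \<le> s\<^sup>2"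
  shows "measure M {\<omega> \<in> space M. block n \<omega> \<in> {x. length x = n \<and> bad x \<le> s}} \<ge> 1 - s"
proof -
  interpret prob_space M by fact
  define T where "T = {x :: 'a list. length x = n \<and> bad x \<le> s}"
  define U where "U = {x :: 'a list. length x = n} - T"
  let ?p = "\<lambda>x. prob {\<omega> \<in> space M. block n \<omega> = x}"
  have finU: "finite U" by (simp add: U_def finite_words)
  have "prob {\<omega> \<in> space M. block n \<omega> \<in> U} * s = (\<Sum>x\<in>U. ?p x * s)"
    by (simp add: prob_block_eq_sum[OF assms(1,2) finU] sum_distrib_right)
  also have "\<dots> \<le> (\<Sum>x\<in>U. ?p x * bad x)"
    by (intro sum_mono mult_left_mono) (auto simp: U_def T_def)
  also have "\<dots> \<le> (\<Sum>x\<in>{xs. length xs = n}. ?p x * bad x)"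
    using assms(4) by (intro sum_mono2) (auto simp: U_def finite_words)
  also have "\<dots> \<le> s * s" using assms(5) by (simp add: power2_eq_square)
  finally have U: "prob {\<omega> \<in> space M. block n \<omega> \<in> U} \<le> s" using assms(3) by simp
  have "{\<omega> \<in> space M. block n \<omega> \<in> T} = space M - {\<omega> \<in> space M. block n \<omega> \<in> U}"
    by (auto simp: U_def T_def block_def)
  moreover have "{\<omega> \<in> space M. block n \<omega> \<in> U} \<in> sets M"
    unfolding block_def by (rule sets_map_coords[OF assms(2)])
  ultimately show ?thesis using prob_compl U by (simp add: T_def)
qed

section \<open>Degenerate codes and the asymptotic error bound\<close>

lemma exists_valid_code: "\<exists>C. \<forall>ed\<in>set_pmf C. valid_code n R ed"
  by (intro exI[of _ "return_pmf (\<lambda>_. replicate n undefined, \<lambda>_. None)"])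
    (simp add: valid_code_def)

lemma code_error_le_1: "code_error c n C m \<le> 1"
proof -
  let ?g = "\<lambda>(enc, dec). measure_pmf.prob (c n (enc m)) {y. dec y \<noteq> Some m}"
  have "0 \<le> ?g ed" "?g ed \<le> 1" for ed by (simp_all split: prod.split)
  then show ?thesis
    unfolding code_error_def
    by (intro measure_pmf.integral_le_const measure_pmf.integrable_const_bound[where B=1] AE_pmfI)
      simp_all
qed

text \<open>The finitely many short block lengths receive an arbitrary valid code and the trivial
  error bound 1, which does not affect the limit.\<close>

lemma reliably_achievableI_eventually:
  fixes c :: "nat \<Rightarrow> 'a list \<Rightarrow> 'a list pmf"
  assumes "\<delta> \<longlonglongrightarrow> (0::real)"
    and "\<forall>\<^sub>F n in sequentially. \<exists>C. (\<forall>ed\<in>set_pmf C. valid_code n R ed) \<and>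
           (\<forall>m\<in>msgs n R. code_error c n C m \<le> \<delta> n)"
  shows "reliably_achievable c R"
proof -
  obtain n0 where n0: "\<And>n. n \<ge> n0 \<Longrightarrow> \<exists>C. (\<forall>ed\<in>set_pmf C. valid_code n R ed) \<and>
           (\<forall>m\<in>msgs n R. code_error c n C m \<le> \<delta> n)"
    using assms(2) by (auto simp: eventually_sequentially)
  define \<delta>' where "\<delta>' n = (if n \<ge> n0 then \<delta> n else 1)" for n
  have "\<exists>C. (\<forall>ed\<in>set_pmf C. valid_code n R ed) \<and> (\<forall>m\<in>msgs n R. code_error c n C m \<le> \<delta>' n)" for n
    using n0[of n] exists_valid_code[of n R] code_error_le_1[of c n] by (cases "n \<ge> n0") (auto simp: \<delta>'_def)
  then obtain C where "\<And>n. (\<forall>ed\<in>set_pmf (C n). valid_code n R ed) \<and>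
      (\<forall>m\<in>msgs n R. code_error c n (C n) m \<le> \<delta>' n)" by metis
  moreover have "\<delta>' \<longlonglongrightarrow> 0"
  proof (rule Lim_transform_eventually[OF assms(1)])
    show "\<forall>\<^sub>F n in sequentially. \<delta> n = \<delta>' n"
      by (rule eventually_sequentiallyI[of n0]) (simp add: \<delta>'_def)
  qed
  ultimately show ?thesis unfolding reliably_achievable_def by blast
qed

text \<open>The truncated exponent is 0, so there is a single message, and a decoder that always
  answers 1 never errs.\<close>

lemma reliably_achievable_nonpos_rate:
  fixes c :: "nat \<Rightarrow> 'a list \<Rightarrow> 'a list pmf"
  assumes "R \<le> 0"
  shows "reliably_achievable c R"
proof (rule reliably_achievableI_eventually[of "\<lambda>_. 0"])
  have "msgs n R = {1}" for n
    using mult_nonneg_nonpos[of "real n" R] assms by (simp add: msgs_def)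
  then have "(\<forall>ed\<in>set_pmf (return_pmf (\<lambda>_. replicate n undefined, \<lambda>_. Some 1)). valid_code n R ed) \<and>
    (\<forall>m\<in>msgs n R. code_error c n (return_pmf (\<lambda>_. replicate n undefined, \<lambda>_. Some 1)) m \<le> 0)" for n
    by (simp add: valid_code_def code_error_def)
  then show "\<forall>\<^sub>F n in sequentially. \<exists>C. (\<forall>ed\<in>set_pmf C. valid_code n R ed) \<and>
           (\<forall>m\<in>msgs n R. code_error c n C m \<le> 0)" by (intro always_eventually) blast
qed simp

text \<open>The harmonic loss of the greedy cover is only linear in \<open>n\<close>, since
  \<open>harm\<close> grows like a logarithm, whereas the gap between \<open>R\<close> and
  \<open>R'\<close> gives exponential decay.\<close>

lemma code_size_times_harm_tendsto_0:
  assumes "0 \<le> R" "R < R'" "K \<ge> (1::nat)"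
  shows "(\<lambda>n. real (card (msgs n R)) * (harm (K ^ n) / 2 powr (real n * R'))) \<longlonglongrightarrow> 0"
proof -
  \<comment> \<open>The added 1 keeps \<open>a\<close> positive even when
    \<open>K = 1\<close>.\<close>
  define a where "a = ln (real K) + 1"
  define \<kappa> where "\<kappa> = R' - R"
  have a: "a > 0" using assms(3) by (simp add: a_def add_nonneg_pos)
  have \<kappa>: "\<kappa> > 0" using assms(2) by (simp add: \<kappa>_def)
  have "real (card (msgs n R)) * (harm (K ^ n) / 2 powr (real n * R'))
      \<le> (1 + real n * a) * 2 powr (- \<kappa> * real n)" for n
  proof -
    have "real (card (msgs n R)) = 2 powr real (nat \<lfloor>real n * R\<rfloor>)"
      by (simp add: msgs_def powr_realpow)
    also have "\<dots> \<le> 2 powr (real n * R)"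
      using assms(1) by (intro powr_mono) auto
    finally have 1: "real (card (msgs n R)) \<le> 2 powr (real n * R)" .
    have "harm (K ^ n) \<le> 1 + ln (real (K ^ n))" using assms(3) by (intro harm_le_ln) simp
    also have "\<dots> \<le> 1 + real n * a" using assms(3) by (simp add: ln_realpow a_def algebra_simps)
    finally have 2: "harm (K ^ n) \<le> 1 + real n * a" .
    have "real (card (msgs n R)) * (harm (K ^ n) / 2 powr (real n * R'))
       \<le> 2 powr (real n * R) * ((1 + real n * a) / 2 powr (real n * R'))"
      using 1 2 by (intro mult_mono divide_right_mono) (auto simp: harm_nonneg)
    also have "\<dots> = (1 + real n * a) * 2 powr (- \<kappa> * real n)"
      by (simp add: \<kappa>_def powr_diff algebra_simps)
    finally show ?thesis .
  qed
  moreover have "(\<lambda>n. (1 + real n * a) * 2 powr (- \<kappa> * real n)) \<longlonglongrightarrow> 0"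
    using a \<kappa> by real_asymp
  ultimately show ?thesis
    by - (rule tendsto_sandwich[OF always_eventually always_eventually tendsto_const],
      simp_all add: harm_nonneg)
qed

section \<open>From direct communication to reliable communication\<close>

theorem theorem1:
  fixes M :: "(nat \<Rightarrow> 'a::finite) measure"
    and d :: "'a \<Rightarrow> 'a \<Rightarrow> real"
    and D R :: real
    and c :: "nat \<Rightarrow> 'a list \<Rightarrow> 'a list pmf"
  assumes "prob_space M"
    and "sets M = sets seq_space"
    and "stationary M"
    and "psi_mixing M"
    and "\<forall>x y. d x y \<ge> 0"
    and "\<forall>x. d x x = 0"
    and "D > 0"
    and "is_channel c"
    and "directly_communicates M d c D"
    and "R < RD_P M d D"
  shows "reliably_achievable c R"
proof (cases "R \<le> 0")
  case True
  then show ?thesis by (rule reliably_achievable_nonpos_rate)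
next
  case False
  interpret prob_space M by fact
  \<comment> \<open>Two gaps are needed: the one between \<open>R'\<close> and \<open>R1\<close>
    pays for concatenating covers, the one between \<open>R\<close> and \<open>R'\<close> makes the
    number of codewords negligible against the covering number.\<close>
  obtain R1 where R1: "R < R1" "R1 < RD_P M d D" using dense[OF assms(10)] by blast
  obtain R' where R': "R < R'" "R' < R1" using dense[OF R1(1)] by blast
  have "\<not> source_achievable M d D R1"
  proof
    assume "source_achievable M d D R1"
    moreover have "bdd_below {R. source_achievable M d D R}"
      by (rule bdd_belowI[of _ 0]) (simp add: source_achievable_def)
    ultimately have "RD_P M d D \<le> R1" unfolding RD_P_def by (intro cInf_lower) auto
    then show False using R1 by simp
  qed
  then have "\<not> (\<forall>\<eta>>0. \<forall>N. \<exists>n\<ge>N. \<exists>S. S \<subseteq> {xs. length xs = n} \<and>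
           real (card S) \<le> 2 powr (real n * R') \<and>
           prob {\<omega> \<in> space M. block n \<omega> \<in> covered d D n S} \<ge> 1 - \<eta>)"
    using source_achievable_of_infinitely_many_covers[OF assms(1-3), of D d R' R1]
      assms(6,7) False R' by force
  then obtain \<eta> N where \<eta>: "\<eta> > 0" and "\<And>n S. n \<ge> N \<Longrightarrow> \<not> (S \<subseteq> {xs. length xs = n} \<and>
           real (card S) \<le> 2 powr (real n * R') \<and>
           prob {\<omega> \<in> space M. block n \<omega> \<in> covered d D n S} \<ge> 1 - \<eta>)"
    by blast
  then have hard: "\<And>n S. n \<ge> N \<Longrightarrow> S \<subseteq> {xs. length xs = n} \<Longrightarrow>
      prob {\<omega> \<in> space M. block n \<omega> \<in> covered d D n S} \<ge> 1 - \<eta> \<Longrightarrow>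
      real (card S) > 2 powr (real n * R')"
    by (meson not_le)
  obtain w where w: "w \<longlonglongrightarrow> 0" "\<And>n. n \<ge> 1 \<Longrightarrow> (\<Sum>xs \<in> {xs. length xs = n}.
            prob {\<omega> \<in> space M. block n \<omega> = xs}
            * measure_pmf.prob (c n xs) {y. dist_n d xs y / real n > D}) \<le> w n"
    using assms(9) unfolding directly_communicates_def by blast
  \<comment> \<open>The square root fits the \<open>s\<^sup>2\<close> in
    \<open>prob_good_inputs\<close>; the absolute value allows negative \<open>w n\<close>, and the
    added term makes \<open>s n\<close> strictly positive.\<close>
  define s where "s n = sqrt (\<bar>w n\<bar> + 1 / real (Suc n))" for n
  have s_pos: "s n > 0" for n by (simp add: s_def add_nonneg_pos)
  have s_sq: "w n \<le> (s n)\<^sup>2" for n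
  proof -
    have "(s n)\<^sup>2 = \<bar>w n\<bar> + 1 / real (Suc n)" by (simp add: s_def)
    then show ?thesis by (simp add: add_increasing2)
  qed
  have "(\<lambda>n. sqrt (\<bar>w n\<bar> + 1 / real (Suc n))) \<longlonglongrightarrow> sqrt (\<bar>0\<bar> + 0)"
    by (intro tendsto_intros w LIMSEQ_inverse_real_of_nat[unfolded inverse_eq_divide])
  then have s_lim: "s \<longlonglongrightarrow> 0" by (simp add: s_def[abs_def])
  define T where "T n = {x. length x = n \<and>
      measure_pmf.prob (c n x) {y. dist_n d x y / real n > D} \<le> s n}" for n
  let ?\<delta> = "\<lambda>n. s n + real (card (msgs n R)) * (harm (CARD('a) ^ n) / 2 powr (real n * R'))"
  have "?\<delta> \<longlonglongrightarrow> 0 + 0"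
    using False R' by (intro tendsto_add s_lim code_size_times_harm_tendsto_0) (auto simp: Suc_leI)
  then have "?\<delta> \<longlonglongrightarrow> 0" by simp
  then show ?thesis
  proof (rule reliably_achievableI_eventually)
    have "\<forall>\<^sub>F n in sequentially. s n < \<eta>" using order_tendstoD(2)[OF s_lim \<eta>] .
    then show "\<forall>\<^sub>F n in sequentially. \<exists>C. (\<forall>ed\<in>set_pmf C. valid_code n R ed) \<and>
           (\<forall>m\<in>msgs n R. code_error c n C m \<le> ?\<delta> n)"
      using eventually_ge_at_top[of "max 1 N"]
    proof eventually_elim
      case (elim n)
      then have n: "n \<ge> 1" "n \<ge> N" by auto
      have good: "prob {\<omega> \<in> space M. block n \<omega> \<in> T n} \<ge> 1 - s n"
        unfolding T_def using w(2)[OF n(1)] s_sq[of n]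
        by (intro prob_good_inputs[OF assms(1,2) s_pos]) auto
      \<comment> \<open>Once \<open>s n < \<eta>\<close>, a cover of \<open>T n\<close> also covers
        source probability at least \<open>1 - \<eta>\<close>, so \<open>hard\<close> applies to
        it.\<close>
      have "real (card S) > 2 powr (real n * R')"
        if S: "S \<subseteq> {xs. length xs = n}" "T n \<subseteq> covered d D n S" for S
      proof (rule hard[OF n(2) S(1)])
        have "{\<omega> \<in> space M. block n \<omega> \<in> covered d D n S} \<in> sets M"
          unfolding block_def by (rule sets_map_coords[OF assms(2)])
        then have "prob {\<omega> \<in> space M. block n \<omega> \<in> T n} \<le> prob {\<omega> \<in> space M. block n \<omega> \<in> covered d D n S}"
          using S(2) by (intro finite_measure_mono) auto
        then show "1 - \<eta> \<le> prob {\<omega> \<in> space M. block n \<omega> \<in> covered d D n S}"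
          using good elim(1) by linarith
      qed
      then obtain C where C: "\<forall>ed\<in>set_pmf C. valid_code n R ed"
        "\<forall>m\<in>msgs n R. code_error c n C m
           \<le> s n + real (card (msgs n R)) * (harm (card (T n)) / 2 powr (real n * R'))"
        using channel_code_of_uncoverable[OF assms(8), of n D d "2 powr (real n * R')" "s n" R]
          n assms(6,7) unfolding T_def by fastforce
      \<comment> \<open>Replacing \<open>card (T n)\<close> by the number of all words gives an
        error bound whose limit is already known.\<close>
      have "card (T n) \<le> CARD('a) ^ n"
        unfolding card_words[symmetric] by (intro card_mono finite_words) (auto simp: T_def)
      then have "s n + real (card (msgs n R)) * (harm (card (T n)) / 2 powr (real n * R')) \<le> ?\<delta> n"
        by (intro add_left_mono mult_left_mono divide_right_mono harm_mono) auto
      then show ?case using C by (intro exI[of _ C]) (auto intro: order_trans)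
    qed
  qed
qed

end
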